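(* In multihop Peg Duotaire, let $P\subseteq\{0,1\}^*$ be the set of words $w$ such that the position $w$ is a $\mathcal{P}$-position, and let $N=\{0,1\}^*\setminus P$ be the set of words whose position is an $\mathcal{N}$-position. Then neither $P$ nor $N$ is a regular language, and neither is a context-free language.
   Context: Peg Duotaire is an impartial two-player game played on the infinite line of sites indexed by $\mathbb{Z}$, each site holding a peg or being a hole, with finitely many pegs. A word $w\in\{0,1\}^*$ denotes the position in which $w$ is written on consecutive sites ($1$ = peg, $0$ = hole) and all other sites are holes. A hop: for a peg at site $i$, a peg at site $i+d$ and a hole at site $i+2d$ ($d=\pm1$), move the peg from $i$ to $i+2d$ and remove the peg at $i+d$. In the multihop version, a move is a sequence of one or more hops all performed by the same peg. Players alternate moves; a player unable to move loses. A $\mathcal{P}$-position is one from which the player who just moved (the second player) has a winning strategy, equivalently nim-value $0$; an $\mathcal{N}$-position is one from which the player to move wins, equivalently nonzero nim-value. *)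

theory Defs
  imports Main
begin

text \<open>A position is a finite set of integer sites carrying a peg.
  A word (True = peg, False = hole) is written on sites 0, ..., length w - 1.\<close>

definition pos_of_word :: "bool list \<Rightarrow> int set" where
  "pos_of_word w = {int k | k. k < length w \<and> w ! k}"

definition hop :: "int set \<Rightarrow> int \<Rightarrow> int \<Rightarrow> int set \<Rightarrow> bool" where
  "hop S i d T \<longleftrightarrow> (d = 1 \<or> d = -1) \<and> i \<in> S \<and> i + d \<in> S \<and> i + 2*d \<notin> S
     \<and> T = insert (i + 2*d) (S - {i, i + d})"

inductive hops :: "int set \<Rightarrow> int \<Rightarrow> int set \<Rightarrow> int \<Rightarrow> bool" where
  one: "hop S i d T \<Longrightarrow> hops S i T (i + 2*d)"
| more: "hop S i d U \<Longrightarrow> hops U (i + 2*d) T j \<Longrightarrow> hops S i T j"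

definition move :: "int set \<Rightarrow> int set \<Rightarrow> bool" where
  "move S T \<longleftrightarrow> (\<exists>i j. hops S i T j)"

inductive Npos :: "int set \<Rightarrow> bool" and Ppos :: "int set \<Rightarrow> bool" where
  N_intro: "move S T \<Longrightarrow> Ppos T \<Longrightarrow> Npos S"
| P_intro: "(\<forall>T. move S T \<longrightarrow> Npos T) \<Longrightarrow> Ppos S"

definition P_words :: "bool list set" where
  "P_words = {w. Ppos (pos_of_word w)}"

definition N_words :: "bool list set" where
  "N_words = UNIV - P_words"

definition regular_lang :: "'a list set \<Rightarrow> bool" where
  "regular_lang L \<longleftrightarrow> (\<exists>(Q::nat set) \<delta> q0 F.
      finite Q \<and> q0 \<in> Q \<and> F \<subseteq> Q \<and> (\<forall>q\<in>Q. \<forall>a. \<delta> q a \<in> Q) \<and>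
      L = {w. fold (\<lambda>a q. \<delta> q a) w q0 \<in> F})"

text \<open>Context-free grammars: nonterminals are naturals (Inl), terminals are Inr;
  a production (A, \<gamma>) rewrites nonterminal A to the sentential form \<gamma>.\<close>
definition cfg_step :: "(nat \<times> (nat + 'a) list) set \<Rightarrow> (nat + 'a) list \<Rightarrow> (nat + 'a) list \<Rightarrow> bool" where
  "cfg_step R u v \<longleftrightarrow> (\<exists>\<alpha> \<beta> A \<gamma>. (A, \<gamma>) \<in> R \<and> u = \<alpha> @ [Inl A] @ \<beta> \<and> v = \<alpha> @ \<gamma> @ \<beta>)"

definition context_free_lang :: "'a list set \<Rightarrow> bool" where
  "context_free_lang L \<longleftrightarrow> (\<exists>(R :: (nat \<times> (nat + 'a) list) set) S.
      finite R \<and> L = {w. (cfg_step R)\<^sup>*\<^sup>* [Inl S] (map Inr w)})"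

end

theory Submission
  imports Defs "HOL-Library.Multiset"
begin

text \<open>In the word 1(10)^n the first peg can hop to the right any number of times up to n, which leaves
  the same pattern with a smaller n, while the only other move kills the pattern. Hence it is a Nim heap
  of size n, and three such patterns separated by 00 are a P-position iff the Nim sum of
  their sizes is zero.

  Non-regularity follows from the pairs of equal heaps. For non-context-freeness we use a commutative
  pumping argument that, in contrast to the usual pumping lemma, works for a language and its
  complement alike. Take the product of a grammar with an automaton and record a derivation by the
  multiset of rules it uses. By Dickson's lemma, among infinitely many derivations there are two with
  rule multisets X and X + Y of the same support; then Y is balanced, so it splits into cycles that
  can be spliced into X, and X + t Y is again a derivation for all t. Applied to the heaps
  (n, 2n, 3n), this shows that with a sequence of values n the language contains a whole arithmetic
  progression through two of them. The Nim sum of these heaps vanishes iff n has no two adjacent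
  binary ones, and every progression through two powers of two contains an n with adjacent ones, while
  every progression through two numbers of the form 3 * 2^m contains an n without.\<close>

unbundle bit_operations_syntax

subsection \<open>Commutative derivations\<close>

type_synonym ('n, 'w) crule = "'n \<times> 'n multiset \<times> 'w multiset"

abbreviation crule_lhs :: "('n, 'w) crule \<Rightarrow> 'n" where
  "crule_lhs r \<equiv> fst r"

abbreviation crule_rhs :: "('n, 'w) crule \<Rightarrow> 'n multiset" where
  "crule_rhs r \<equiv> fst (snd r)"

abbreviation lhs_total :: "('n, 'w) crule multiset \<Rightarrow> 'n multiset" where
  "lhs_total X \<equiv> image_mset crule_lhs X"

abbreviation rhs_total :: "('n, 'w) crule multiset \<Rightarrow> 'n multiset" where
  "rhs_total X \<equiv> \<Sum>\<^sub># (image_mset crule_rhs X)"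

abbreviation output_total :: "('n, 'w) crule multiset \<Rightarrow> 'w multiset" where
  "output_total X \<equiv> \<Sum>\<^sub># (image_mset (\<lambda>r. snd (snd r)) X)"

text \<open>Firing sequences of a Petri net in which each transition consumes one token. The middle
  argument records the rules with multiplicity; the order of nonterminals is forgotten.\<close>

inductive derives :: "'n multiset \<Rightarrow> ('n, 'w) crule multiset \<Rightarrow> 'n multiset \<Rightarrow> bool" where
  derives_refl: "derives M {#} M"
| derives_step: "derives (M + crule_rhs r) X M' \<Longrightarrow> derives (add_mset (crule_lhs r) M) (add_mset r X) M'"

lemma derives_trans: "derives M X M' \<Longrightarrow> derives M' Y M'' \<Longrightarrow> derives M (X + Y) M''"
  by (induction rule: derives.induct) (auto intro: derives.intros)

lemma derives_frame: "derives M X M' \<Longrightarrow> derives (M + K) X (M' + K)"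
proof (induction rule: derives.induct)
  case (derives_step M r X M')
  then have "derives ((M + K) + crule_rhs r) X (M' + K)"
    by (simp add: ac_simps)
  from derives.derives_step[OF this] show ?case by simp
qed (rule derives_refl)

lemma derives_single: "derives (add_mset (crule_lhs r) M) {#r#} (M + crule_rhs r)"
  by (rule derives_step) (rule derives_refl)

lemma derives_balance: "derives M X M' \<Longrightarrow> M + rhs_total X = M' + lhs_total X"
proof (induction rule: derives.induct)
  case (derives_step M r X M')
  have "add_mset (crule_lhs r) M + rhs_total (add_mset r X)
      = add_mset (crule_lhs r) ((M + crule_rhs r) + rhs_total X)" by (simp add: ac_simps)
  then show ?case using derives_step.IH by simp
qed simp

text \<open>A derivation of maximal length from a single nonterminal, using only rules of \<^term>\<open>Y\<close>, can be
  extended neither at its start nor at its end; balance then forces it to be a cycle.\<close>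

lemma balanced_contains_cycle:
  fixes Y :: "('n, 'w) crule multiset"
  assumes "Y \<noteq> {#}" and bal: "rhs_total Y = lhs_total Y"
  obtains B C where "C \<noteq> {#}" "C \<subseteq># Y" "derives {#B#} C {#B#}"
proof -
  define Q where "Q C \<longleftrightarrow> C \<noteq> {#} \<and> C \<subseteq># Y \<and> (\<exists>B M. derives {#B#} C M)" for C
  obtain r where "r \<in># Y" using \<open>Y \<noteq> {#}\<close> by blast
  then have "Q {#r#}"
    unfolding Q_def using derives_single[of r "{#}"] by auto
  moreover have "\<forall>C. Q C \<longrightarrow> size C < Suc (size Y)"
    by (auto simp: Q_def less_Suc_eq_le size_mset_mono)
  ultimately obtain C where "Q C" and max: "\<And>D. Q D \<Longrightarrow> size D \<le> size C"
    using ex_has_greatest_nat[of Q _ size] by metis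
  then obtain B M where C: "C \<noteq> {#}" "C \<subseteq># Y" and der: "derives {#B#} C M"
    unfolding Q_def by blast
  obtain D where Y: "Y = C + D" using C(2) by (metis subset_mset.add_diff_inverse)
  have "(M + lhs_total C) + rhs_total D = ({#B#} + rhs_total C) + rhs_total D"
    by (simp only: derives_balance[OF der])
  also have "\<dots> = {#B#} + rhs_total Y" by (simp add: Y)
  also have "\<dots> = {#B#} + (lhs_total C + lhs_total D)" by (simp only: bal) (simp add: Y)
  finally have "lhs_total C + (M + rhs_total D) = lhs_total C + add_mset B (lhs_total D)"
    by (simp add: ac_simps)
  then have MD: "M + rhs_total D = add_mset B (lhs_total D)" by (simp only: add_left_cancel)
  have extend: False if "r \<in># D" "derives {#B'#} (add_mset r C) M'" for r B' M'
  proof -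
    have "add_mset r C \<subseteq># Y"
      using that(1) by (auto simp: Y dest: multi_member_split)
    then have "Q (add_mset r C)" using that(2) by (auto simp: Q_def)
    from max[OF this] show False by simp
  qed
  have "B \<in># M"
  proof (rule ccontr)
    assume "B \<notin># M"
    moreover have "B \<in># M + rhs_total D" using MD by simp
    ultimately obtain r where r: "r \<in># D" "B \<in># crule_rhs r" by auto
    then obtain N where N: "crule_rhs r = add_mset B N" by (meson multi_member_split)
    have "derives ({#} + crule_rhs r) C (M + N)"
      using derives_frame[OF der, of N] by (simp add: N)
    from derives_step[OF this] show False using extend[OF r(1)] by auto
  qed
  then obtain K where K: "M = add_mset B K" by (meson multi_member_split)
  have KD: "K + rhs_total D = lhs_total D" using MD unfolding K by simp
  have "K = {#}"
  proof (rule ccontr)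
    assume "K \<noteq> {#}"
    then obtain A K' where K': "K = add_mset A K'" by (meson multiset_cases)
    then have "A \<in># lhs_total D" using KD[symmetric] by simp
    then obtain r where r: "r \<in># D" "A = crule_lhs r" by auto
    have "derives M {#r#} (add_mset B K' + crule_rhs r)"
      using derives_single[of r "add_mset B K'"] by (simp add: K K' r(2) add_mset_commute)
    from derives_trans[OF der this] show False using extend[OF r(1)] by auto
  qed
  with that C der K show thesis by blast
qed

text \<open>Just before \<open>r\<close> fires its left side is present, so the cycle
  \<open>Z\<close> can run there and restore it.\<close>

lemma derives_splice:
  assumes "derives M X M'" "r \<in># X" "derives {#crule_lhs r#} Z {#crule_lhs r#}"
  shows "derives M (X + Z) M'"
  using assms
proof (induction rule: derives.induct)
  case (derives_step M s X M')
  show ?case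
  proof (cases "r = s")
    case True
    have "derives (add_mset (crule_lhs s) M) Z (add_mset (crule_lhs s) M)"
      using derives_frame[OF derives_step.prems(2), of M] True by simp
    from derives_trans[OF this derives.derives_step[OF derives_step.hyps]]
    show ?thesis by (simp add: ac_simps)
  next
    case False
    then have "derives (M + crule_rhs s) (X + Z) M'" using derives_step by auto
    from derives.derives_step[OF this] show ?thesis by simp
  qed
qed simp

text \<open>Cycles are split off from \<open>Y\<close> one at a time. The first rule of a cycle
  occurs in \<open>X\<close>, so the cycle can be spliced in there, and the rest of \<open>Y\<close>
  is again balanced and smaller.\<close>

lemma derives_add_balanced:
  assumes "derives M X M'" "rhs_total Y = lhs_total Y" "set_mset Y \<subseteq> set_mset X"
  shows "derives M (X + Y) M'"
  using assms
proof (induction "size Y" arbitrary: X Y rule: less_induct)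
  case less
  show ?case
  proof (cases "Y = {#}")
    case True
    with less.prems show ?thesis by simp
  next
    case False
    then obtain B C where C: "C \<noteq> {#}" "C \<subseteq># Y" "derives {#B#} C {#B#}"
      using balanced_contains_cycle less.prems(2) by blast
    obtain D where Y: "Y = C + D" using C(2) by (metis subset_mset.add_diff_inverse)
    have "rhs_total C = lhs_total C" using derives_balance[OF C(3)] by simp
    then have D: "rhs_total D = lhs_total D" using less.prems(2) by (simp add: Y)
    from C(3,1) obtain r where r: "r \<in># C" "B = crule_lhs r"
      by (cases rule: derives.cases) auto
    have "r \<in># X" using r(1) less.prems(3) by (auto simp: Y)
    then have "derives M (X + C) M'"
      using derives_splice[OF less.prems(1)] C(3) r(2) by blast
    moreover have "size D < size Y" using C(1) by (simp add: Y nonempty_has_size)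
    moreover have "set_mset D \<subseteq> set_mset (X + C)" using less.prems(3) by (auto simp: Y)
    ultimately have "derives M (X + C + D) M'" using less.hyps[of D "X + C"] D by blast
    then show ?thesis by (simp add: Y ac_simps)
  qed
qed

text \<open>Comparing the balance equations of the two derivations shows that \<open>Y\<close> is
  balanced, so it can be added repeatedly.\<close>

lemma derives_pump:
  assumes "derives M X M'" "derives M (X + Y) M'" "set_mset Y \<subseteq> set_mset X"
  shows "derives M (X + repeat_mset t Y) M'"
proof (induction t)
  case (Suc t)
  have "(M + rhs_total X) + rhs_total Y = (M' + lhs_total X) + lhs_total Y"
    using derives_balance[OF assms(2)] by (simp add: ac_simps)
  then have "rhs_total Y = lhs_total Y"
    by (simp only: derives_balance[OF assms(1)] add_left_cancel)
  moreover have "set_mset Y \<subseteq> set_mset (X + repeat_mset t Y)" using assms(3) by auto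
  ultimately have "derives M (X + repeat_mset t Y + Y) M'"
    using derives_add_balanced[OF Suc] by blast
  then show ?case by (simp add: ac_simps)
qed (use assms in simp)

section \<open>Monotone subsequences and Dickson's lemma for multisets\<close>

lemma nat_seq_mono_subseq:
  fixes f :: "nat \<Rightarrow> nat"
  obtains g :: "nat \<Rightarrow> nat" where "strict_mono g" "mono (\<lambda>n. f (g n))"
proof -
  \<comment> \<open>An index beyond \<open>n\<close> at which \<open>f\<close> is least bounds all
    later values from below; \<open>g\<close> iterates this choice.\<close>
  have step: "\<exists>k>n. \<forall>l>k. f k \<le> f l" for n
    using ex_has_least_nat[of "\<lambda>k. k > n" "Suc n" f] by (metis less_trans lessI)
  define g where "g = rec_nat (SOME k. k > 0 \<and> (\<forall>l>k. f k \<le> f l)) (\<lambda>_ n. SOME k. k > n \<and> (\<forall>l>k. f k \<le> f l))"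
  have g0: "\<forall>l>g 0. f (g 0) \<le> f l"
    using someI_ex[OF step[of 0]] by (simp add: g_def)
  have gS: "g (Suc n) > g n \<and> (\<forall>l>g (Suc n). f (g (Suc n)) \<le> f l)" for n
    using someI_ex[OF step[of "g n"]] by (simp add: g_def)
  have low: "\<forall>l>g n. f (g n) \<le> f l" for n
    using g0 gS by (cases n) auto
  have "strict_mono g" using gS by (simp add: strict_mono_Suc_iff)
  moreover have "mono (\<lambda>n. f (g n))"
    unfolding mono_iff_le_Suc using gS low by blast
  ultimately show thesis using that by blast
qed

lemma multiset_seq_mono_subseq:
  fixes f :: "nat \<Rightarrow> 'a multiset"
  assumes "finite A"
  shows "\<exists>g :: nat \<Rightarrow> nat. strict_mono g \<and> (\<forall>a\<in>A. mono (\<lambda>n. count (f (g n)) a))"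
  using assms
proof (induction A rule: finite_induct)
  case empty
  show ?case by (auto intro!: exI[of _ id] simp: strict_mono_def)
next
  case (insert a A)
  then obtain g :: "nat \<Rightarrow> nat" where g: "strict_mono g" "\<forall>b\<in>A. mono (\<lambda>n. count (f (g n)) b)" by blast
  obtain h :: "nat \<Rightarrow> nat" where h: "strict_mono h" "mono (\<lambda>n. count (f (g (h n))) a)"
    by (rule nat_seq_mono_subseq[of "\<lambda>n. count (f (g n)) a"])
  have "strict_mono (g \<circ> h)" using g(1) h(1) by (simp add: strict_mono_def)
  moreover have "mono (\<lambda>n. count (f ((g \<circ> h) n)) b)" if "b \<in> insert a A" for b
  proof (cases "b = a")
    case False
    then have "mono (\<lambda>n. count (f (g n)) b)" using that g(2) by blast
    from monoD[OF this monoD[OF strict_mono_mono[OF h(1)]]] show ?thesis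
      by (intro monoI) (simp only: o_apply)
  qed (use h(2) in simp)
  ultimately show ?case by blast
qed

text \<open>Equal supports come from the pigeonhole principle on the subsets of \<open>A\<close>.
  They ensure that every added rule already occurs in the smaller multiset, as
  \<open>derives_pump\<close> requires.\<close>

lemma dickson_same_support:
  fixes f :: "nat \<Rightarrow> 'a multiset"
  assumes "finite A" "\<And>n. set_mset (f n) \<subseteq> A"
  obtains m n where "m < n" "f m \<subseteq># f n" "set_mset (f n) = set_mset (f m)"
proof -
  obtain g :: "nat \<Rightarrow> nat" where g: "strict_mono g" "\<forall>a\<in>A. mono (\<lambda>n. count (f (g n)) a)"
    using multiset_seq_mono_subseq[OF assms(1)] by blast
  have "finite (range (\<lambda>n. set_mset (f (g n))))"
    by (rule finite_subset[of _ "Pow A"]) (use assms in auto)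
  then have "\<not> inj (\<lambda>n. set_mset (f (g n)))" using finite_imageD[of _ "UNIV :: nat set"] infinite_UNIV_nat by blast
  then obtain i j where "i \<noteq> j" "set_mset (f (g i)) = set_mset (f (g j))"
    by (auto simp: inj_def)
  then obtain i j where ij: "i < j" "set_mset (f (g j)) = set_mset (f (g i))"
    by (cases i j rule: linorder_cases) auto
  have "f (g i) \<subseteq># f (g j)"
  proof (rule mset_subset_eqI)
    fix a
    show "count (f (g i)) a \<le> count (f (g j)) a"
    proof (cases "a \<in> A")
      case True
      then have "mono (\<lambda>n. count (f (g n)) a)" using g(2) by blast
      from monoD[OF this, of i j] show ?thesis using ij(1) by simp
    next
      case False
      then have "a \<notin># f (g i)" using assms(2) by blast
      then show ?thesis by (simp add: not_in_iff)
    qed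
  qed
  moreover have "g i < g j" using g(1) ij(1) by (simp add: strict_mono_less)
  ultimately show thesis using that ij(2) by blast
qed

subsection \<open>Simultaneous pumping in context-free languages\<close>

abbreviation run :: "('q \<Rightarrow> 'a \<Rightarrow> 'q) \<Rightarrow> 'q \<Rightarrow> 'a list \<Rightarrow> 'q" where
  "run \<delta> q w \<equiv> fold (\<lambda>a q. \<delta> q a) w q"

text \<open>A Parikh image refined by the automaton: each letter counts under the state in which it
  is read, and the final state is left out.\<close>

fun trace :: "('q \<Rightarrow> 'a \<Rightarrow> 'q) \<Rightarrow> 'q \<Rightarrow> 'a list \<Rightarrow> 'q multiset" where
  "trace \<delta> q [] = {#}"
| "trace \<delta> q (a # w) = add_mset q (trace \<delta> (\<delta> q a) w)"

lemma trace_append: "trace \<delta> q (u @ v) = trace \<delta> q u + trace \<delta> (run \<delta> q u) v"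
  by (induction u arbitrary: q) auto

section \<open>Product of a grammar with an automaton\<close>

locale grammar_automaton =
  fixes R :: "(nat \<times> (nat + 'a) list) set"
    and Q :: "'q set"
    and \<delta> :: "'q \<Rightarrow> 'a \<Rightarrow> 'q"
  assumes finite_R: "finite R"
    and finite_Q: "finite Q"
    and \<delta>_closed: "q \<in> Q \<Longrightarrow> \<delta> q a \<in> Q"
begin

text \<open>In \<^term>\<open>reads u q q' N Z\<close> the automaton goes from \<^term>\<open>q\<close> to \<^term>\<open>q'\<close> along the
  sentential form \<^term>\<open>u\<close>, guessing the state after each nonterminal; \<^term>\<open>N\<close> collects the
  nonterminals together with their guessed end states, \<^term>\<open>Z\<close> the states in which terminals
  are read.\<close>

inductive reads :: "(nat + 'a) list \<Rightarrow> 'q \<Rightarrow> 'q \<Rightarrow> ('q \<times> nat \<times> 'q) multiset \<Rightarrow> 'q multiset \<Rightarrow> bool" where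
  reads_Nil: "q \<in> Q \<Longrightarrow> reads [] q q {#} {#}"
| reads_Inr: "q \<in> Q \<Longrightarrow> reads u (\<delta> q a) q' N Z \<Longrightarrow> reads (Inr a # u) q q' N (add_mset q Z)"
| reads_Inl: "q \<in> Q \<Longrightarrow> reads u p q' N Z \<Longrightarrow> reads (Inl A # u) q q' (add_mset (q, A, p) N) Z"

inductive_cases reads_NilE: "reads [] q q' N Z"
inductive_cases reads_InrE: "reads (Inr a # u) q q' N Z"
inductive_cases reads_InlE: "reads (Inl A # u) q q' N Z"

lemma reads_in_Q: "reads u q q' N Z \<Longrightarrow> q \<in> Q \<and> q' \<in> Q"
  by (induction rule: reads.induct) auto

lemma reads_append:
  "reads u q p N Z \<Longrightarrow> reads v p q' N' Z' \<Longrightarrow> reads (u @ v) q q' (N + N') (Z + Z')"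
  by (induction rule: reads.induct) (auto intro: reads.intros)

lemma reads_appendE:
  assumes "reads (u @ v) q q' N Z"
  obtains p N1 Z1 N2 Z2 where "reads u q p N1 Z1" "reads v p q' N2 Z2" "N = N1 + N2" "Z = Z1 + Z2"
  using assms
proof (induction u arbitrary: q N Z thesis)
  case Nil
  show ?case
    by (rule Nil.prems(1)[of q "{#}" "{#}" N Z])
      (use Nil.prems(2) reads_in_Q in \<open>auto intro: reads.intros\<close>)
next
  case (Cons x u)
  show ?case
  proof (cases x)
    case (Inl A)
    with Cons.prems(2) obtain p N' where 1: "q \<in> Q" "reads (u @ v) p q' N' Z" "N = add_mset (q, A, p) N'"
      by (auto elim: reads_InlE)
    from Cons.IH[OF _ 1(2)] obtain p' N1 Z1 N2 Z2 where
      "reads u p p' N1 Z1" "reads v p' q' N2 Z2" "N' = N1 + N2" "Z = Z1 + Z2" by metis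
    with 1 Inl show ?thesis
      by (intro Cons.prems(1)[of p' "add_mset (q, A, p) N1" Z1 N2 Z2]) (auto intro: reads.intros)
  next
    case (Inr a)
    with Cons.prems(2) obtain Z' where 1: "q \<in> Q" "reads (u @ v) (\<delta> q a) q' N Z'" "Z = add_mset q Z'"
      by (auto elim: reads_InrE)
    from Cons.IH[OF _ 1(2)] obtain p' N1 Z1 N2 Z2 where
      "reads u (\<delta> q a) p' N1 Z1" "reads v p' q' N2 Z2" "N = N1 + N2" "Z' = Z1 + Z2" by metis
    with 1 Inr show ?thesis
      by (intro Cons.prems(1)[of p' N1 "add_mset q Z1" N2 Z2]) (auto intro: reads.intros)
  qed
qed

text \<open>The multiset \<open>N\<close> does not say where a triple comes from, so some occurrence
  is picked; any will do, since later only totals matter.\<close>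

lemma reads_split_nonterminal:
  assumes "reads u q q' N Z" "(p, A, p') \<in># N"
  obtains v w N1 Z1 N2 Z2 where "u = v @ [Inl A] @ w" "reads v q p N1 Z1" "reads w p' q' N2 Z2"
    "N = add_mset (p, A, p') (N1 + N2)" "Z = Z1 + Z2"
  using assms
proof (induction arbitrary: thesis rule: reads.induct)
  case (reads_Inr q u a q' N Z)
  from reads_Inr.IH[OF _ reads_Inr.prems(2)] obtain v w N1 Z1 N2 Z2 where
    "u = v @ [Inl A] @ w" "reads v (\<delta> q a) p N1 Z1" "reads w p' q' N2 Z2"
    "N = add_mset (p, A, p') (N1 + N2)" "Z = Z1 + Z2" by metis
  with reads_Inr.hyps(1) show ?case
    by (intro reads_Inr.prems(1)[of "Inr a # v" w N1 "add_mset q Z1" N2 Z2]) (auto intro: reads.intros)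
next
  case (reads_Inl q u r q' N Z B)
  show ?case
  proof (cases "(p, A, p') = (q, B, r)")
    case True
    with reads_Inl.hyps show ?thesis
      by (intro reads_Inl.prems(1)[of "[]" u "{#}" "{#}" N Z]) (auto intro: reads.intros)
  next
    case False
    then have "(p, A, p') \<in># N" using reads_Inl.prems(2) by auto
    from reads_Inl.IH[OF _ this] obtain v w N1 Z1 N2 Z2 where
      "u = v @ [Inl A] @ w" "reads v r p N1 Z1" "reads w p' q' N2 Z2"
      "N = add_mset (p, A, p') (N1 + N2)" "Z = Z1 + Z2" by metis
    with reads_Inl.hyps(1) show ?thesis
      by (intro reads_Inl.prems(1)[of "Inl B # v" w "add_mset (q, B, r) N1" Z1 N2 Z2])
        (auto intro: reads.intros)
  qed
qed simp

lemma reads_word: "q \<in> Q \<Longrightarrow> reads (map Inr w) q (run \<delta> q w) {#} (trace \<delta> q w)"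
  by (induction w arbitrary: q) (auto intro: reads.intros \<delta>_closed)

lemma reads_no_nonterminal:
  "reads u q q' N Z \<Longrightarrow> N = {#} \<Longrightarrow> \<exists>w. u = map Inr w \<and> run \<delta> q w = q' \<and> trace \<delta> q w = Z"
proof (induction rule: reads.induct)
  case (reads_Inr q u a q' N Z)
  then obtain w where "u = map Inr w \<and> run \<delta> (\<delta> q a) w = q' \<and> trace \<delta> (\<delta> q a) w = Z" by blast
  then show ?case by (intro exI[of _ "a # w"]) simp
qed auto

text \<open>The Bar-Hillel triple construction: \<open>(q, A, q')\<close> stands for derivations
  from \<open>A\<close> whose words lead from \<open>q\<close> to \<open>q'\<close>. A rule outputs
  the states in which its own terminals are read.\<close>

definition product_rules :: "('q \<times> nat \<times> 'q, 'q) crule set" where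
  "product_rules = {((q, A, q'), N, Z) | q A q' N Z. \<exists>\<gamma>. (A, \<gamma>) \<in> R \<and> reads \<gamma> q q' N Z}"

text \<open>For fixed \<open>u\<close> a reading is determined by its start state and the states
  guessed after the nonterminals. Finiteness of the product rules, needed for Dickson's lemma, rests
  on this.\<close>

lemma finite_reads: "finite {(q, q', N, Z). reads u q q' N Z}"
proof (induction u)
  case Nil
  have "{(q, q', N, Z). reads [] q q' N Z} \<subseteq> (\<lambda>q. (q, q, {#}, {#})) ` Q"
    by (auto elim: reads_NilE)
  then show ?case by (rule finite_subset) (simp add: finite_Q)
next
  case (Cons x u)
  let ?S = "{(q, q', N, Z). reads u q q' N Z}"
  show ?case
  proof (cases x)
    case (Inl A)
    have "{(q, q', N, Z). reads (x # u) q q' N Z}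
        \<subseteq> (\<lambda>(q, p, q', N, Z). (q, q', add_mset (q, A, p) N, Z)) ` (Q \<times> ?S)"
      by (force simp: Inl elim: reads_InlE)
    then show ?thesis by (rule finite_subset) (intro finite_imageI finite_cartesian_product finite_Q Cons)
  next
    case (Inr a)
    have "{(q, q', N, Z). reads (x # u) q q' N Z}
        \<subseteq> (\<lambda>(q, p, q', N, Z). (q, q', N, add_mset q Z)) ` (Q \<times> ?S)"
      by (force simp: Inr elim: reads_InrE)
    then show ?thesis by (rule finite_subset) (intro finite_imageI finite_cartesian_product finite_Q Cons)
  qed
qed

lemma finite_product_rules: "finite product_rules"
proof -
  have "product_rules \<subseteq> (\<Union>(A, \<gamma>)\<in>R.
      (\<lambda>(q, q', N, Z). ((q, A, q'), N, Z)) ` {(q, q', N, Z). reads \<gamma> q q' N Z})"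
    unfolding product_rules_def by force
  moreover have "finite \<dots>" using finite_R finite_reads by auto
  ultimately show ?thesis by (rule finite_subset)
qed

text \<open>Induction from the end of the grammar derivation: the reading of \<open>v\<close> is cut
  around \<gamma>, and the middle piece becomes a product rule that is applied first.\<close>

lemma derives_of_word:
  assumes "(cfg_step R)\<^sup>*\<^sup>* u (map Inr w)" "q \<in> Q"
  obtains N Z X where "reads u q (run \<delta> q w) N Z" "derives N X {#}"
    "set_mset X \<subseteq> product_rules" "trace \<delta> q w = Z + output_total X"
  using assms(1)
proof (induction arbitrary: thesis rule: converse_rtranclp_induct)
  case base
  show ?case
    by (rule base[of "{#}" "trace \<delta> q w" "{#}"])
      (use reads_word[OF assms(2)] in \<open>auto intro: derives.intros\<close>)
next
  case (step u v)
  from step.hyps(1) obtain \<alpha> \<beta> A \<gamma> where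
    A: "(A, \<gamma>) \<in> R" "u = \<alpha> @ [Inl A] @ \<beta>" "v = \<alpha> @ \<gamma> @ \<beta>"
    unfolding cfg_step_def by blast
  from step.IH obtain N Z X where IH: "reads v q (run \<delta> q w) N Z" "derives N X {#}"
    "set_mset X \<subseteq> product_rules" "trace \<delta> q w = Z + output_total X" by blast
  from IH(1) obtain p N1 Z1 N' Z' where 1: "reads \<alpha> q p N1 Z1" "reads (\<gamma> @ \<beta>) p (run \<delta> q w) N' Z'"
    "N = N1 + N'" "Z = Z1 + Z'" unfolding A by (rule reads_appendE)
  from 1(2) obtain p' N2 Z2 N3 Z3 where 2: "reads \<gamma> p p' N2 Z2" "reads \<beta> p' (run \<delta> q w) N3 Z3"
    "N' = N2 + N3" "Z' = Z2 + Z3" by (rule reads_appendE)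
  let ?r = "((p, A, p'), N2, Z2)"
  have "reads ([Inl A] @ \<beta>) p (run \<delta> q w) (add_mset (p, A, p') N3) Z3"
    using 2 reads_in_Q by (auto intro: reads.intros)
  from reads_append[OF 1(1) this]
  have "reads u q (run \<delta> q w) (add_mset (p, A, p') (N1 + N3)) (Z1 + Z3)" by (simp add: A)
  moreover have "derives (add_mset (p, A, p') (N1 + N3)) (add_mset ?r X) {#}"
    using derives_step[of "N1 + N3" ?r X] IH(2) 1(3) 2(3) by (simp add: ac_simps)
  moreover have "?r \<in> product_rules" using A(1) 2(1) by (auto simp: product_rules_def)
  then have "set_mset (add_mset ?r X) \<subseteq> product_rules" using IH(3) by simp
  moreover have "trace \<delta> q w = (Z1 + Z3) + output_total (add_mset ?r X)"
    using IH(4) 1(4) 2(4) by (simp add: ac_simps)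
  ultimately show ?case by (rule step.prems)
qed

text \<open>Each product rule is realised by a grammar step at some occurrence of its triple. The
  choice may change the word, but not the end state or the trace.\<close>

lemma word_of_derives:
  assumes "derives N X M" "M = {#}" "set_mset X \<subseteq> product_rules" "reads u q q' N Z"
  shows "\<exists>w. (cfg_step R)\<^sup>*\<^sup>* u (map Inr w) \<and> run \<delta> q w = q' \<and> trace \<delta> q w = Z + output_total X"
  using assms
proof (induction arbitrary: u Z rule: derives.induct)
  case (derives_refl M)
  then show ?case using reads_no_nonterminal by fastforce
next
  case (derives_step M r X M')
  from derives_step.prems(2) have "r \<in> product_rules" by simp
  then obtain p A p' N2 Z2 \<gamma> where r: "r = ((p, A, p'), N2, Z2)" "(A, \<gamma>) \<in> R" "reads \<gamma> p p' N2 Z2"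
    unfolding product_rules_def by blast
  have "(p, A, p') \<in># add_mset (crule_lhs r) M" by (simp add: r)
  from reads_split_nonterminal[OF derives_step.prems(3) this]
  obtain v w N1 Z1 N3 Z3 where s: "u = v @ [Inl A] @ w" "reads v q p N1 Z1" "reads w p' q' N3 Z3"
    "add_mset (crule_lhs r) M = add_mset (p, A, p') (N1 + N3)" "Z = Z1 + Z3" by metis
  have "cfg_step R u (v @ \<gamma> @ w)" unfolding cfg_step_def using r(2) s(1) by blast
  moreover have "M = N1 + N3" using s(4) by (simp add: r)
  then have "reads (v @ \<gamma> @ w) q q' (M + crule_rhs r) (Z1 + (Z2 + Z3))"
    using reads_append[OF s(2) reads_append[OF r(3) s(3)]] by (simp add: r ac_simps)
  then obtain x where "(cfg_step R)\<^sup>*\<^sup>* (v @ \<gamma> @ w) (map Inr x)" "run \<delta> q x = q'"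
    "trace \<delta> q x = (Z1 + (Z2 + Z3)) + output_total X"
    using derives_step.IH[of "v @ \<gamma> @ w" "Z1 + (Z2 + Z3)"] derives_step.prems by auto
  ultimately show ?case
    by (intro exI[of _ x]) (auto simp: r s(5) ac_simps intro: converse_rtranclp_into_rtranclp)
qed

text \<open>Dickson's lemma is applied to the rule multisets of derivations of the words
  \<open>w n\<close>; \<open>D\<close> is the output of the difference of two of them.\<close>

lemma simultaneous_pumping_grammar:
  fixes w :: "nat \<Rightarrow> 'a list"
  assumes "\<And>n. (cfg_step R)\<^sup>*\<^sup>* [Inl S] (map Inr (w n))" "q0 \<in> Q" "\<And>n. run \<delta> q0 (w n) = qf"
  obtains m n D where "m < n" "trace \<delta> q0 (w n) = trace \<delta> q0 (w m) + D"
    "\<And>t. \<exists>x. (cfg_step R)\<^sup>*\<^sup>* [Inl S] (map Inr x) \<and> run \<delta> q0 x = qf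
        \<and> trace \<delta> q0 x = trace \<delta> q0 (w m) + repeat_mset t D"
proof -
  let ?N = "{#(q0, S, qf)#}"
  have "\<exists>X. derives ?N X {#} \<and> set_mset X \<subseteq> product_rules \<and> trace \<delta> q0 (w n) = output_total X" for n
  proof -
    obtain N Z X where X: "reads [Inl S] q0 qf N Z" "derives N X {#}"
      "set_mset X \<subseteq> product_rules" "trace \<delta> q0 (w n) = Z + output_total X"
      using derives_of_word[OF assms(1)[of n] assms(2)] unfolding assms(3) by metis
    from X(1) have "N = ?N" "Z = {#}" by (auto elim!: reads_InlE reads_NilE)
    with X show ?thesis by auto
  qed
  then obtain X where X: "\<And>n. derives ?N (X n) {#}" "\<And>n. set_mset (X n) \<subseteq> product_rules"
    "\<And>n. trace \<delta> q0 (w n) = output_total (X n)" by metis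
  obtain m n where mn: "m < n" "X m \<subseteq># X n" "set_mset (X n) = set_mset (X m)"
    by (rule dickson_same_support[OF finite_product_rules X(2)])
  obtain Y where Y: "X n = X m + Y" using mn(2) by (metis subset_mset.add_diff_inverse)
  have sub: "set_mset Y \<subseteq> set_mset (X m)" using mn(3) by (auto simp: Y)
  \<comment> \<open>The reading belonging to \<open>w 0\<close> shows that \<open>qf\<close> lies in
    \<open>Q\<close>.\<close>
  have run_start: "reads [Inl S] q0 qf ?N {#}"
    using derives_of_word[OF assms(1)[of 0] assms(2)] unfolding assms(3)
    by (auto elim!: reads_InlE reads_NilE intro: reads.intros)
  have "\<exists>x. (cfg_step R)\<^sup>*\<^sup>* [Inl S] (map Inr x) \<and> run \<delta> q0 x = qf
      \<and> trace \<delta> q0 x = trace \<delta> q0 (w m) + repeat_mset t (output_total Y)" for t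
  proof -
    have "derives ?N (X m + repeat_mset t Y) {#}"
      using derives_pump[OF X(1) _ sub] X(1)[of n] by (simp add: Y)
    moreover have "set_mset (repeat_mset t Y) \<subseteq> set_mset Y" by (induction t) auto
    then have "set_mset (X m + repeat_mset t Y) \<subseteq> product_rules"
      using X(2)[of m] sub by auto
    moreover have "output_total (repeat_mset t Y) = repeat_mset t (output_total Y)"
      by (induction t) auto
    ultimately show ?thesis
      using word_of_derives[OF _ refl _ run_start, of "X m + repeat_mset t Y"] X(3)[of m] by simp
  qed
  moreover have "trace \<delta> q0 (w n) = trace \<delta> q0 (w m) + output_total Y" using X(3) by (simp add: Y)
  ultimately show thesis using that[of m n "output_total Y"] mn(1) by blast
qed

end

lemma context_free_simultaneous_pumping:
  fixes L :: "'a list set" and \<delta> :: "'q \<Rightarrow> 'a \<Rightarrow> 'q"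
  assumes "context_free_lang L" "finite Q" "\<And>q a. q \<in> Q \<Longrightarrow> \<delta> q a \<in> Q" "q0 \<in> Q"
    and "\<And>n :: nat. w n \<in> L" "\<And>n. run \<delta> q0 (w n) = qf"
  obtains m n D where "m < n" "trace \<delta> q0 (w n) = trace \<delta> q0 (w m) + D"
    "\<And>t. \<exists>x\<in>L. run \<delta> q0 x = qf \<and> trace \<delta> q0 x = trace \<delta> q0 (w m) + repeat_mset t D"
proof -
  obtain R S where R: "finite R" "L = {w. (cfg_step R)\<^sup>*\<^sup>* [Inl S] (map Inr w)}"
    using assms(1) unfolding context_free_lang_def by blast
  interpret grammar_automaton R Q \<delta>
    by unfold_locales (fact R(1), fact assms(2), fact assms(3))
  have in_L: "(cfg_step R)\<^sup>*\<^sup>* [Inl S] (map Inr (w n))" for n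
    using assms(5)[of n] by (simp only: R(2) mem_Collect_eq)
  show thesis
  proof (rule simultaneous_pumping_grammar[of S w, OF in_L assms(4) assms(6)])
    fix m n D
    assume "m < n" "trace \<delta> q0 (w n) = trace \<delta> q0 (w m) + D"
      "\<And>t. \<exists>x. (cfg_step R)\<^sup>*\<^sup>* [Inl S] (map Inr x) \<and> run \<delta> q0 x = qf
        \<and> trace \<delta> q0 x = trace \<delta> q0 (w m) + repeat_mset t D"
    then show thesis by (intro that[of m n D]) (simp_all only: R(2) Bex_def mem_Collect_eq)
  qed
qed

subsection \<open>Peg heaps\<close>

text \<open>A heap is located by the site \<^term>\<open>x\<close> that its first peg reaches after hopping as far as
  possible, because \<^term>\<open>x\<close> does not change during play. A leftward hop over the first peg of
  \<open>heap x v\<close> results in \<open>dead x v\<close>.\<close>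

definition heap :: "int \<Rightarrow> nat \<Rightarrow> int set" where
  "heap x v = insert (x - 2 * int v) {x - 2 * int l - 1 | l. l < v}"

definition dead :: "int \<Rightarrow> nat \<Rightarrow> int set" where
  "dead x v = {x - 2 * int l - 1 | l. l \<le> v \<and> l \<noteq> v - 1}"

text \<open>Here \<open>n\<close> is the initial size, which bounds the sites in use, and
  \<open>v\<close> is the current Nim value. A dead pattern has no adjacent pegs, hence value
  0.\<close>

definition component :: "int \<Rightarrow> nat \<Rightarrow> nat \<Rightarrow> int set \<Rightarrow> bool" where
  "component x n v C \<longleftrightarrow> v \<le> n \<and> C = heap x v \<or> v = 0 \<and> (\<exists>k\<in>{1..n}. C = dead x k)"

text \<open>The lower end is where the leftward hop in a heap of size \<open>n\<close> lands. One
  further site on each side is kept clear by \<open>far_from\<close>, so that no peg of the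
  component has a foreign neighbour.\<close>

abbreviation window :: "int \<Rightarrow> nat \<Rightarrow> int set" where
  "window x n \<equiv> {x - 2 * int n - 1..x}"

abbreviation far_from :: "int set \<Rightarrow> int \<Rightarrow> nat \<Rightarrow> bool" where
  "far_from B x n \<equiv> B \<inter> {x - 2 * int n - 2..x + 1} = {}"

lemma component_subset_window: "component x n v C \<Longrightarrow> C \<subseteq> window x n"
  by (auto simp: component_def heap_def dead_def)

text \<open>The first peg is at even distance from \<open>x\<close> and all others at odd distance,
  so an adjacent pair consists of the first peg and the next one.\<close>

lemma heap_adjacent:
  assumes "i \<in> heap x v" "i + d \<in> heap x v" "d = 1 \<or> d = -1"
  shows "v \<ge> 1 \<and> (d = 1 \<and> i = x - 2 * int v \<or> d = -1 \<and> i = x - 2 * int v + 1)"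
  using assms unfolding heap_def by (auto; presburger)

lemma dead_not_adjacent:
  assumes "i \<in> dead x v" "i + d \<in> dead x v" "d = 1 \<or> d = -1"
  shows False
  using assms unfolding dead_def by (auto; presburger)

text \<open>A quantifier-free parity condition lets \<open>presburger\<close> compare patterns
  before and after a hop.\<close>

lemma mem_heap: "i \<in> heap x v \<longleftrightarrow> i = x - 2 * int v \<or> (odd (x - i) \<and> x - 2 * int v < i \<and> i < x)"
proof -
  have "(\<exists>l. i = x - 2 * int l - 1 \<and> l < v) \<longleftrightarrow> (odd (x - i) \<and> x - 2 * int v < i \<and> i < x)"
  proof
    assume r: "odd (x - i) \<and> x - 2 * int v < i \<and> i < x"
    then have "odd (x - i)" by blast
    then obtain k where k: "x - i = 2 * k + 1" by (rule oddE)
    with r have "i = x - 2 * int (nat k) - 1" "nat k < v" by auto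
    then show "\<exists>l. i = x - 2 * int l - 1 \<and> l < v" by blast
  qed auto
  then show ?thesis by (auto simp: heap_def)
qed

lemma mem_dead: "v \<ge> 1 \<Longrightarrow> i \<in> dead x v \<longleftrightarrow>
    odd (x - i) \<and> x - 2 * int v - 1 \<le> i \<and> i < x \<and> i \<noteq> x - 2 * int v + 1"
proof -
  assume v: "v \<ge> 1"
  have "(\<exists>l. i = x - 2 * int l - 1 \<and> l \<le> v \<and> l \<noteq> v - 1) \<longleftrightarrow>
    (odd (x - i) \<and> x - 2 * int v - 1 \<le> i \<and> i < x \<and> i \<noteq> x - 2 * int v + 1)"
  proof
    assume r: "odd (x - i) \<and> x - 2 * int v - 1 \<le> i \<and> i < x \<and> i \<noteq> x - 2 * int v + 1"
    then have "odd (x - i)" by blast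
    then obtain k where k: "x - i = 2 * k + 1" by (rule oddE)
    with r v have "i = x - 2 * int (nat k) - 1" "nat k \<le> v" "nat k \<noteq> v - 1" by auto
    then show "\<exists>l. i = x - 2 * int l - 1 \<and> l \<le> v \<and> l \<noteq> v - 1" by blast
  qed (use v in auto)
  then show ?thesis by (auto simp: dead_def)
qed

lemma hop_right_result:
  assumes "v \<ge> 1" "v \<le> n" "far_from B x n"
  shows "insert (x - 2 * int v + 2) (heap x v \<union> B - {x - 2 * int v, x - 2 * int v + 1})
    = heap x (v - 1) \<union> B"
proof (rule set_eqI)
  fix i
  have "i \<notin> B" if "i = x - 2 * int v \<or> i = x - 2 * int v + 1"
    using assms that by (auto simp: disjoint_iff)
  moreover have "i = x - 2 * int v + 2 \<or> i \<in> heap x v \<and> i \<noteq> x - 2 * int v \<and> i \<noteq> x - 2 * int v + 1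
    \<longleftrightarrow> i \<in> heap x (v - 1)"
    using assms(1) unfolding mem_heap by presburger
  ultimately show "i \<in> insert (x - 2 * int v + 2) (heap x v \<union> B - {x - 2 * int v, x - 2 * int v + 1})
      \<longleftrightarrow> i \<in> heap x (v - 1) \<union> B" by blast
qed

lemma hop_left_result:
  assumes "v \<ge> 1" "v \<le> n" "far_from B x n"
  shows "insert (x - 2 * int v - 1) (heap x v \<union> B - {x - 2 * int v + 1, x - 2 * int v})
    = dead x v \<union> B"
proof (rule set_eqI)
  fix i
  have "i \<notin> B" if "i = x - 2 * int v \<or> i = x - 2 * int v + 1"
    using assms that by (auto simp: disjoint_iff)
  moreover have "i = x - 2 * int v - 1 \<or> i \<in> heap x v \<and> i \<noteq> x - 2 * int v \<and> i \<noteq> x - 2 * int v + 1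
    \<longleftrightarrow> i \<in> dead x v"
    using assms(1) unfolding mem_heap mem_dead[OF assms(1)] by presburger
  ultimately show "i \<in> insert (x - 2 * int v - 1) (heap x v \<union> B - {x - 2 * int v + 1, x - 2 * int v})
      \<longleftrightarrow> i \<in> dead x v \<union> B" by blast
qed

text \<open>A rightward hop lowers the size by one and a leftward hop kills the pattern. The landing
  site is kept in the conclusion so that the next hop of the same peg starts in the same
  component.\<close>

lemma component_hop:
  assumes "component x n v C" "far_from B x n" "hop (C \<union> B) i d U" "i \<in> C"
  shows "\<exists>v'<v. \<exists>C'. component x n v' C' \<and> U = C' \<union> B \<and> i + 2 * d \<in> C'"
proof -
  have d: "d = 1 \<or> d = -1" and U: "U = insert (i + 2 * d) (C \<union> B - {i, i + d})"
    and "i + d \<in> C \<union> B" using assms(3) by (auto simp: hop_def)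
  moreover have "i \<in> window x n" using component_subset_window assms(1,4) by blast
  then have "i + d \<in> {x - 2 * int n - 2..x + 1}" using d by auto
  ultimately have id: "i + d \<in> C" using assms(2) by blast
  have C: "v \<le> n" "C = heap x v"
    using assms(1,4) id d dead_not_adjacent unfolding component_def by blast+
  from heap_adjacent[of i x v d] assms(4) id d C have v: "v \<ge> 1"
    and "d = 1 \<and> i = x - 2 * int v \<or> d = -1 \<and> i = x - 2 * int v + 1" by blast+
  then consider (right) "d = 1" "i = x - 2 * int v" | (left) "d = -1" "i = x - 2 * int v + 1" by blast
  then show ?thesis
  proof cases
    case right
    then have "U = heap x (v - 1) \<union> B"
      using U hop_right_result[OF v C(1) assms(2)] by (simp add: C(2))
    moreover have "component x n (v - 1) (heap x (v - 1))" using C(1) by (auto simp: component_def)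
    moreover have "i + 2 * d \<in> heap x (v - 1)" using right v by (auto simp: heap_def)
    ultimately show ?thesis using v by (intro exI[of _ "v - 1"]) auto
  next
    case left
    then have "U = dead x v \<union> B"
      using U hop_left_result[OF v C(1) assms(2)] by (simp add: C(2))
    moreover have "component x n 0 (dead x v)" using C(1) v by (auto simp: component_def)
    moreover have "i + 2 * d \<in> dead x v" using left v by (auto simp: mem_dead)
    ultimately show ?thesis using v by (intro exI[of _ 0]) auto
  qed
qed

lemma component_hops:
  assumes "hops S i T j" "S = C \<union> B" "component x n v C" "far_from B x n" "i \<in> C"
  shows "\<exists>v'<v. \<exists>C'. component x n v' C' \<and> T = C' \<union> B"
  using assms
proof (induction arbitrary: C v rule: hops.induct)
  case (one S i d T)
  then show ?case using component_hop by blast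
next
  case (more S i d U T j)
  from component_hop[OF more.prems(2,3) more.hyps(1)[unfolded more.prems(1)] more.prems(4)]
  obtain v1 C1 where 1: "v1 < v" "component x n v1 C1" "U = C1 \<union> B" "i + 2 * d \<in> C1" by blast
  from more.IH[OF 1(3,2) more.prems(3) 1(4)]
  obtain v' C' where "v' < v1" "component x n v' C'" "T = C' \<union> B" by blast
  with 1(1) show ?case by (intro exI[of _ v']) auto
qed

text \<open>Here multihops matter: \<open>v - v'\<close> rightward hops of the first peg form one
  move, so every smaller size is reachable at once, as in Nim.\<close>

lemma heap_hops:
  assumes "v' < v" "v \<le> n" "far_from B x n"
  shows "hops (heap x v \<union> B) (x - 2 * int v) (heap x v' \<union> B) (x - 2 * int v')"
  using assms(1,2)
proof (induction v)
  case (Suc v)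
  have "x - 2 * int (Suc v) \<in> heap x (Suc v)" "x - 2 * int (Suc v) + 1 \<in> heap x (Suc v)"
    "x - 2 * int (Suc v) + 2 \<notin> heap x (Suc v)" by (auto simp: mem_heap)
  moreover have "x - 2 * int (Suc v) + 2 \<notin> B" using assms(3) Suc.prems(2) by (auto simp: disjoint_iff)
  ultimately have hop: "hop (heap x (Suc v) \<union> B) (x - 2 * int (Suc v)) 1 (heap x v \<union> B)"
    using hop_right_result[of "Suc v" n B x] Suc.prems(2) assms(3) by (auto simp: hop_def)
  have *: "x - 2 * int (Suc v) + 2 * 1 = x - 2 * int v" by simp
  show ?case
  proof (cases "v' = v")
    case True
    then show ?thesis using hops.one[OF hop] * by simp
  next
    case False
    then have "hops (heap x v \<union> B) (x - 2 * int v) (heap x v' \<union> B) (x - 2 * int v')"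
      using Suc by simp
    then show ?thesis using hops.more[OF hop] * by metis
  qed
qed simp

lemma component_move:
  assumes "component x n v C" "far_from B x n" "v' < v"
  shows "\<exists>C'. component x n v' C' \<and> move (C \<union> B) (C' \<union> B)"
proof -
  have "v \<le> n" "C = heap x v" using assms(1,3) by (auto simp: component_def)
  then have "component x n v' (heap x v')" "move (C \<union> B) (heap x v' \<union> B)"
    using heap_hops[OF assms(3) _ assms(2)] assms(3) by (auto simp: component_def move_def)
  then show ?thesis by blast
qed

section \<open>Sums of three separated heaps\<close>

locale three_heaps =
  fixes x0 x1 x2 :: int and n0 n1 n2 :: nat
  assumes sep01: "x0 + 2 \<le> x1 - 2 * int n1 - 1"
    and sep12: "x1 + 2 \<le> x2 - 2 * int n2 - 1"
begin

definition nim_position :: "nat \<Rightarrow> nat \<Rightarrow> nat \<Rightarrow> int set \<Rightarrow> bool" where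
  "nim_position a b c S \<longleftrightarrow> (\<exists>C0 C1 C2. component x0 n0 a C0 \<and> component x1 n1 b C1
     \<and> component x2 n2 c C2 \<and> S = C0 \<union> C1 \<union> C2)"

lemma components_far:
  assumes "component x0 n0 a C0" "component x1 n1 b C1" "component x2 n2 c C2"
  shows "far_from (C1 \<union> C2) x0 n0" "far_from (C0 \<union> C2) x1 n1" "far_from (C0 \<union> C1) x2 n2"
proof -
  have "C0 \<subseteq> window x0 n0" "C1 \<subseteq> window x1 n1" "C2 \<subseteq> window x2 n2"
    using assms component_subset_window by blast+
  then have w: "\<And>i. i \<in> C0 \<Longrightarrow> i \<in> window x0 n0" "\<And>i. i \<in> C1 \<Longrightarrow> i \<in> window x1 n1"
    "\<And>i. i \<in> C2 \<Longrightarrow> i \<in> window x2 n2" by blast+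
  show "far_from (C1 \<union> C2) x0 n0" "far_from (C0 \<union> C2) x1 n1" "far_from (C0 \<union> C1) x2 n2"
    using sep01 sep12 by (fastforce dest: w)+
qed

lemma nim_position_move:
  assumes "nim_position a b c S" "move S T"
  shows "(\<exists>a'<a. nim_position a' b c T) \<or> (\<exists>b'<b. nim_position a b' c T)
    \<or> (\<exists>c'<c. nim_position a b c' T)"
proof -
  obtain C0 C1 C2 where C: "component x0 n0 a C0" "component x1 n1 b C1" "component x2 n2 c C2"
    and S: "S = C0 \<union> C1 \<union> C2" using assms(1) unfolding nim_position_def by blast
  note far = components_far[OF C]
  obtain i j where h: "hops S i T j" using assms(2) unfolding move_def by blast
  then have "i \<in> S" by (cases rule: hops.cases) (auto simp: hop_def)
  then consider "i \<in> C0" | "i \<in> C1" | "i \<in> C2" using S by blast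
  then show ?thesis
  proof cases
    case 1
    have "S = C0 \<union> (C1 \<union> C2)" using S by blast
    from component_hops[OF h this C(1) far(1) 1] C show ?thesis
      unfolding nim_position_def by (metis Un_assoc)
  next
    case 2
    have "S = C1 \<union> (C0 \<union> C2)" using S by blast
    from component_hops[OF h this C(2) far(2) 2] C show ?thesis
      unfolding nim_position_def by (metis Un_assoc Un_left_commute)
  next
    case 3
    have "S = C2 \<union> (C0 \<union> C1)" using S by blast
    from component_hops[OF h this C(3) far(3) 3] C show ?thesis
      unfolding nim_position_def by (metis Un_commute)
  qed
qed

lemma nim_position_move_to:
  assumes "nim_position a b c S"
  shows "a' < a \<Longrightarrow> \<exists>T. move S T \<and> nim_position a' b c T"
    and "b' < b \<Longrightarrow> \<exists>T. move S T \<and> nim_position a b' c T"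
    and "c' < c \<Longrightarrow> \<exists>T. move S T \<and> nim_position a b c' T"
proof -
  obtain C0 C1 C2 where C: "component x0 n0 a C0" "component x1 n1 b C1" "component x2 n2 c C2"
    and S: "S = C0 \<union> C1 \<union> C2" using assms(1) unfolding nim_position_def by blast
  note far = components_far[OF C]
  have S': "S = C0 \<union> (C1 \<union> C2)" "S = C1 \<union> (C0 \<union> C2)" "S = C2 \<union> (C0 \<union> C1)" using S by auto
  show "\<exists>T. move S T \<and> nim_position a' b c T" if "a' < a"
    using component_move[OF C(1) far(1) that] C S'(1) unfolding nim_position_def
    by (metis Un_assoc)
  show "\<exists>T. move S T \<and> nim_position a b' c T" if "b' < b"
    using component_move[OF C(2) far(2) that] C S'(2) unfolding nim_position_def
    by (metis Un_assoc Un_left_commute)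
  show "\<exists>T. move S T \<and> nim_position a b c' T" if "c' < c"
    using component_move[OF C(3) far(3) that] C S'(3) unfolding nim_position_def
    by (metis Un_commute)
qed

end

section \<open>Bouton's theorem for three heaps\<close>

lemma xor_cancel_eq: "a XOR b = a XOR c \<longleftrightarrow> b = (c :: nat)"
  by (metis xor.assoc xor_self_eq xor.left_neutral)

text \<open>The winning move is found by recursion that strips the lowest binary digit, instead of
  looking for the highest digit of the Nim sum.\<close>

lemma nim_sum_winning_move:
  fixes a b c :: nat
  assumes "a XOR b \<noteq> c"
  shows "b XOR c < a \<or> a XOR c < b \<or> a XOR b < c"
  using assms
proof (induction "a + b + c" arbitrary: a b c rule: less_induct)
  case less
  show ?case
  proof (cases "(a div 2) XOR (b div 2) = c div 2")
    \<comment> \<open>Only the lowest digits are out of balance: an odd number of the heaps is odd,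
      and lowering one of these by 1 wins.\<close>
    case True
    then have eqs: "(b div 2) XOR (c div 2) = a div 2" "(a div 2) XOR (c div 2) = b div 2"
      by (metis xor.assoc xor.commute xor_self_eq xor.left_neutral)+
    have r: "a XOR b = of_bool (odd a \<noteq> odd b) + 2 * (c div 2)"
       "b XOR c = of_bool (odd b \<noteq> odd c) + 2 * (a div 2)"
       "a XOR c = of_bool (odd a \<noteq> odd c) + 2 * (b div 2)"
      using xor_rec[of a b] xor_rec[of b c] xor_rec[of a c] True eqs by simp_all
    show ?thesis using less.prems unfolding r by (cases "odd a"; cases "odd b"; cases "odd c"; simp; presburger)
  next
    case False
    then have "a div 2 + b div 2 + c div 2 < a + b + c"
      by (cases "a = 0 \<and> b = 0 \<and> c = 0") (simp, linarith)
    from less.hyps[OF this False]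
    have "(b div 2) XOR (c div 2) < a div 2 \<or> (a div 2) XOR (c div 2) < b div 2
      \<or> (a div 2) XOR (b div 2) < c div 2" .
    \<comment> \<open>A lowest digit cannot undo a strict inequality between the halves.\<close>
    moreover have "x XOR y < z" if "(x div 2) XOR (y div 2) < z div 2" for x y z :: nat
    proof -
      have "x XOR y \<le> 1 + 2 * ((x div 2) XOR (y div 2))" by (subst xor_rec) simp
      then show ?thesis using that by linarith
    qed
    ultimately show ?thesis by blast
  qed
qed

context three_heaps begin

text \<open>Both predicates are settled together: they are inductive, so it is part of the claim
  that exactly one of them holds.\<close>

lemma nim_position_outcome:
  "nim_position a b c S \<Longrightarrow> (Ppos S \<longleftrightarrow> a XOR b = c) \<and> (Npos S \<longleftrightarrow> a XOR b \<noteq> c)"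
proof (induction "a + b + c" arbitrary: a b c S rule: less_induct)
  case less
  have IH: "(Ppos T \<longleftrightarrow> a' XOR b' = c') \<and> (Npos T \<longleftrightarrow> a' XOR b' \<noteq> c')"
    if "nim_position a' b' c' T" "a' + b' + c' < a + b + c" for a' b' c' T
    using less.hyps that by blast
  show ?case
  proof (cases "a XOR b = c")
    case True
    have "Npos T \<and> \<not> Ppos T" if "move S T" for T
      using nim_position_move[OF less.prems that]
    proof (elim disjE exE conjE)
      fix a' assume "a' < a" "nim_position a' b c T"
      moreover from this have "a' XOR b \<noteq> c" using True by (metis xor_cancel_eq xor.commute less_irrefl)
      ultimately show ?thesis using IH by simp
    next
      fix b' assume "b' < b" "nim_position a b' c T"
      moreover from this have "a XOR b' \<noteq> c" using True by (metis xor_cancel_eq less_irrefl)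
      ultimately show ?thesis using IH by simp
    next
      fix c' assume "c' < c" "nim_position a b c' T"
      then show ?thesis using IH True by simp
    qed
    then show ?thesis using True Npos.simps[of S] Ppos.simps[of S] by blast
  next
    case False
    have "\<exists>T. move S T \<and> Ppos T \<and> \<not> Npos T"
      using nim_sum_winning_move[OF False]
    proof (elim disjE)
      assume lt: "b XOR c < a"
      moreover have "(b XOR c) XOR b = c" by (metis xor.assoc xor.commute xor_self_eq xor.left_neutral)
      ultimately show ?thesis using nim_position_move_to(1)[OF less.prems lt] IH by fastforce
    next
      assume lt: "a XOR c < b"
      moreover have "a XOR (a XOR c) = c" by (metis xor.assoc xor_self_eq xor.left_neutral)
      ultimately show ?thesis using nim_position_move_to(2)[OF less.prems lt] IH by fastforce
    next
      assume lt: "a XOR b < c"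
      then show ?thesis using nim_position_move_to(3)[OF less.prems lt] IH by fastforce
    qed
    then show ?thesis using False Npos.simps[of S] Ppos.simps[of S] by blast
  qed
qed

end

section \<open>Words of heaps and their positions\<close>

fun alternating :: "nat \<Rightarrow> bool list" where
  "alternating 0 = []"
| "alternating (Suc n) = True # False # alternating n"

lemma alternating_snoc: "alternating n @ [True, False] = alternating (Suc n)"
  by (induction n) auto

lemma length_alternating [simp]: "length (alternating n) = 2 * n"
  by (induction n) auto

definition heap_word :: "nat \<Rightarrow> bool list" where
  "heap_word n = True # alternating n"

lemma length_heap_word [simp]: "length (heap_word n) = 2 * n + 1"
  by (simp add: heap_word_def)

lemma heap_word_snoc: "heap_word n @ [True, False] = heap_word (Suc n)"
  using alternating_snoc by (simp add: heap_word_def)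

definition nim_word :: "nat \<Rightarrow> nat \<Rightarrow> nat \<Rightarrow> bool list" where
  "nim_word a b c = heap_word a @ [False, False] @ heap_word b @ [False, False] @ heap_word c"

text \<open>This is \<open>pos_of_word\<close> with a variable origin, as needed for
  concatenation.\<close>

definition sites :: "int \<Rightarrow> bool list \<Rightarrow> int set" where
  "sites s w = {s + int k | k. k < length w \<and> w ! k}"

lemma ex_nat_split: "(\<exists>k :: nat. P k) \<longleftrightarrow> P 0 \<or> (\<exists>k. P (Suc k))"
  by (metis nat.exhaust)

lemma sites_Nil [simp]: "sites s [] = {}"
  by (simp add: sites_def)

lemma sites_Cons [simp]: "sites s (p # w) = (if p then {s} else {}) \<union> sites (s + 1) w"
proof (rule set_eqI)
  fix i
  have "i \<in> sites s (p # w) \<longleftrightarrow> (\<exists>k. i = s + int k \<and> k < Suc (length w) \<and> (p # w) ! k)"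
    by (simp add: sites_def)
  also have "\<dots> \<longleftrightarrow> (i = s \<and> p) \<or> (\<exists>k. i = s + int (Suc k) \<and> k < length w \<and> w ! k)"
    by (subst ex_nat_split) simp
  also have "\<dots> \<longleftrightarrow> i \<in> (if p then {s} else {}) \<union> sites (s + 1) w"
    by (auto simp: sites_def)
  finally show "i \<in> sites s (p # w) \<longleftrightarrow> i \<in> (if p then {s} else {}) \<union> sites (s + 1) w" .
qed

lemma sites_append: "sites s (u @ v) = sites s u \<union> sites (s + int (length u)) v"
  by (induction u arbitrary: s) (auto simp: ac_simps)

lemma sites_alternating: "sites s (alternating n) = {s + 2 * int l | l. l < n}"
proof (induction n)
  case (Suc n)
  have "sites s (alternating (Suc n)) = sites s (alternating n) \<union> {s + 2 * int n}"
    by (simp only: alternating_snoc[symmetric] sites_append) simp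
  then show ?case using Suc by (auto simp: less_Suc_eq)
qed simp

lemma sites_heap_word: "sites s (heap_word n) = heap (s + 2 * int n) n"
proof -
  \<comment> \<open>The word lists the pegs from the left and \<open>heap\<close> from the right;
    \<open>n - 1 - l\<close> converts the index.\<close>
  have "{s + 1 + 2 * int l | l. l < n} = {s + 2 * int n - 2 * int l - 1 | l. l < n}" (is "?A = ?B")
  proof
    show "?A \<subseteq> ?B"
    proof
      fix i assume "i \<in> ?A"
      then obtain l where "l < n" "i = s + 1 + 2 * int l" by blast
      then show "i \<in> ?B" by (intro CollectI exI[of _ "n - 1 - l"]) auto
    qed
    show "?B \<subseteq> ?A"
    proof
      fix i assume "i \<in> ?B"
      then obtain l where "l < n" "i = s + 2 * int n - 2 * int l - 1" by blast
      then show "i \<in> ?A" by (intro CollectI exI[of _ "n - 1 - l"]) auto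
    qed
  qed
  then show ?thesis by (simp add: heap_word_def heap_def sites_alternating)
qed

lemma Ppos_nim_word: "Ppos (pos_of_word (nim_word a b c)) \<longleftrightarrow> a XOR b = c"
proof -
  \<comment> \<open>Each 3 leads from the last site of a heap word across two holes to the first
    site of the next; the separation conditions then hold with equality.\<close>
  define x0 x1 x2 where x: "x0 = 2 * int a" "x1 = x0 + 3 + 2 * int b" "x2 = x1 + 3 + 2 * int c"
  interpret three_heaps x0 x1 x2 a b c by unfold_locales (simp_all add: x)
  have "pos_of_word (nim_word a b c) = sites 0 (nim_word a b c)"
    by (simp add: pos_of_word_def sites_def)
  also have "\<dots> = sites 0 (heap_word a) \<union> sites (x0 + 3) (heap_word b) \<union> sites (x1 + 3) (heap_word c)"
    by (simp add: nim_word_def sites_append x ac_simps)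
  also have "\<dots> = heap x0 a \<union> heap x1 b \<union> heap x2 c"
    by (simp add: sites_heap_word x ac_simps)
  finally have "nim_position a b c (pos_of_word (nim_word a b c))"
    unfolding nim_position_def component_def by blast
  then show ?thesis using nim_position_outcome by blast
qed

subsection \<open>Languages of Nim words\<close>

text \<open>The automaton accepts the words \<^term>\<open>nim_word a b c\<close> in state 10; it reads a letter in the
  states 3, 7 and 11 exactly \<^term>\<open>a\<close>, \<^term>\<open>b\<close> and \<^term>\<open>c\<close> times. State 12 is a sink.\<close>

definition step :: "nat \<Rightarrow> bool \<Rightarrow> nat" where
  "step q p = (if p then
     (if q = 0 then 2 else if q = 2 then 3 else if q = 5 then 6 else if q = 6 then 7
      else if q = 9 then 10 else if q = 10 then 11 else 12)
   else
     (if q = 2 then 4 else if q = 3 then 2 else if q = 4 then 5 else if q = 6 then 8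
      else if q = 7 then 6 else if q = 8 then 9 else if q = 11 then 10 else 12))"

lemma run_alternating:
  assumes "step q True = q'" "step q' False = q"
  shows "run step q (alternating n) = q" "trace step q (alternating n) = repeat_mset n {#q, q'#}"
  using assms by (induction n) auto

lemma step_simps [simp]:
  "step 0 True = 2" "step 2 True = 3" "step 3 False = 2" "step 2 False = 4" "step 4 False = 5"
  "step 5 True = 6" "step 6 True = 7" "step 7 False = 6" "step 6 False = 8" "step 8 False = 9"
  "step 9 True = 10" "step 10 True = 11" "step 11 False = 10"
  by (simp_all add: step_def)

lemmas run_loops = run_alternating[of 2 3, simplified] run_alternating[of 6 7, simplified]
  run_alternating[of 10 11, simplified]

lemma run_nim_word: "run step 0 (nim_word a b c) = 10"
  by (simp add: nim_word_def heap_word_def run_loops)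

lemma trace_nim_word:
  "count (trace step 0 (nim_word a b c)) 3 = a"
  "count (trace step 0 (nim_word a b c)) 7 = b"
  "count (trace step 0 (nim_word a b c)) 11 = c"
  by (simp_all add: nim_word_def heap_word_def trace_append run_loops)

text \<open>The invariant of the automaton: the words leading to each state, with the counts so far.
  A pair 10 counts once its hole is read, so the pending peg in states 3, 7 and 11 is not yet
  counted.\<close>

inductive shape :: "nat \<Rightarrow> nat \<Rightarrow> nat \<Rightarrow> nat \<Rightarrow> bool list \<Rightarrow> bool" where
  "shape 0 0 0 0 []"
| "shape 2 a 0 0 (heap_word a)"
| "shape 3 a 0 0 (heap_word a @ [True])"
| "shape 4 a 0 0 (heap_word a @ [False])"
| "shape 5 a 0 0 (heap_word a @ [False, False])"
| "shape 6 a b 0 (heap_word a @ [False, False] @ heap_word b)"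
| "shape 7 a b 0 (heap_word a @ [False, False] @ heap_word b @ [True])"
| "shape 8 a b 0 (heap_word a @ [False, False] @ heap_word b @ [False])"
| "shape 9 a b 0 (heap_word a @ [False, False] @ heap_word b @ [False, False])"
| "shape 10 a b c (heap_word a @ [False, False] @ heap_word b @ [False, False] @ heap_word c)"
| "shape 11 a b c (heap_word a @ [False, False] @ heap_word b @ [False, False] @ heap_word c @ [True])"
| "shape 12 a b c w"

lemma shape_step:
  assumes "shape q a b c w"
  shows "shape (step q p) (a + of_bool (q = 3)) (b + of_bool (q = 7)) (c + of_bool (q = 11)) (w @ [p])"
proof -
  \<comment> \<open>The transitions into states 2, 6 and 10 that begin a heap read its first peg, a
    heap of size 0.\<close>
  have h0: "heap_word 0 = [True]" by (simp add: heap_word_def)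
  note start = shape.intros(2)[of 0, unfolded h0] shape.intros(6)[of a 0, unfolded h0]
    shape.intros(10)[of a b 0, unfolded h0]
  from assms show ?thesis
    by (cases rule: shape.cases; cases p)
      (use start in \<open>simp_all add: step_def heap_word_snoc shape.intros[simplified]\<close>)
qed

lemma shape_run:
  "shape (run step 0 w) (count (trace step 0 w) 3) (count (trace step 0 w) 7) (count (trace step 0 w) 11) w"
proof (induction w rule: rev_induct)
  case (snoc p w)
  from shape_step[OF this, of p] show ?case by (simp add: trace_append of_bool_def split: if_splits)
qed (simp add: shape.intros)

lemma nim_word_of_run:
  assumes "run step 0 w = 10"
  shows "w = nim_word (count (trace step 0 w) 3) (count (trace step 0 w) 7) (count (trace step 0 w) 11)"
  using shape_run[of w] unfolding assms by (cases rule: shape.cases) (simp_all add: nim_word_def)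

text \<open>The counts in \<open>D\<close> inherit the ratio 1 : 2 : 3 from the two traces, and a
  word ending in state 10 is determined by its counts. So the pumped words are again Nim words of
  this ratio.\<close>

lemma context_free_nim_words:
  fixes f :: "nat \<Rightarrow> nat"
  assumes "context_free_lang L" "\<And>m. nim_word (f m) (2 * f m) (3 * f m) \<in> L"
  obtains m m' where "m < m'"
    "\<forall>t n. n = f m + t * (f m' - f m) \<longrightarrow> nim_word n (2 * n) (3 * n) \<in> L"
proof (rule context_free_simultaneous_pumping
    [of L "{..12}" step 0 "\<lambda>m. nim_word (f m) (2 * f m) (3 * f m)" 10, OF assms(1) _ _ _ assms(2) run_nim_word])
  let ?w = "\<lambda>m. nim_word (f m) (2 * f m) (3 * f m)"
  fix m m' D
  assume D: "m < m'" "trace step 0 (?w m') = trace step 0 (?w m) + D"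
    "\<And>t. \<exists>x\<in>L. run step 0 x = 10 \<and> trace step 0 x = trace step 0 (?w m) + repeat_mset t D"
  have "count (trace step 0 (?w m')) q = count (trace step 0 (?w m)) q + count D q" for q
    by (simp only: D(2) count_union)
  from this[of 3] this[of 7] this[of 11]
  have cD: "f m' = f m + count D 3" "count D 7 = 2 * count D 3" "count D 11 = 3 * count D 3"
    by (simp_all add: trace_nim_word)
  have "nim_word n (2 * n) (3 * n) \<in> L" if n: "n = f m + t * (f m' - f m)" for t n
  proof -
    obtain x where x: "x \<in> L" "run step 0 x = 10" "trace step 0 x = trace step 0 (?w m) + repeat_mset t D"
      using D(3) by blast
    have "count (trace step 0 x) 3 = n" "count (trace step 0 x) 7 = 2 * n" "count (trace step 0 x) 11 = 3 * n"
      by (simp_all add: x(3) trace_nim_word cD n algebra_simps)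
    with nim_word_of_run[OF x(2)] x(1) show ?thesis by simp
  qed
  with D(1) that show thesis by blast
qed (simp_all add: step_def)

section \<open>Binary digits and the identity \<open>n XOR (2 * n) = 3 * n\<close>\<close>

lemma double_xor_double: "(2 * a) XOR (2 * b) = 2 * (a XOR b)" for a b :: nat
  by (subst xor_rec) simp

text \<open>The factor \<open>2 ^ k\<close> shifts all digits alike, so trailing zeros do not affect
  the identity.\<close>

lemma xor_double_power2: "(2 ^ k * n) XOR (2 * (2 ^ k * n)) = 3 * (2 ^ k * n) \<longleftrightarrow> n XOR (2 * n) = 3 * n"
  for n :: nat
proof (induction k)
  case (Suc k)
  define y where "y = 2 ^ k * n"
  have y: "2 ^ Suc k * n = 2 * y" by (simp add: y_def)
  have "(2 * y) XOR (2 * (2 * y)) = 3 * (2 * y) \<longleftrightarrow> y XOR (2 * y) = 3 * y"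
    unfolding double_xor_double by auto
  then show ?case unfolding y using Suc by (simp add: y_def)
qed simp

text \<open>The identity says that adding \<open>n\<close> and \<open>2 * n\<close> causes no carry,
  so that \<open>n\<close> has no adjacent ones; appending the digits 01 preserves this.\<close>

lemma xor_double_4_plus_1:
  assumes "n XOR (2 * n) = 3 * (n :: nat)"
  shows "(4 * n + 1) XOR (2 * (4 * n + 1)) = 3 * (4 * n + 1)"
proof -
  have "(4 * n + 1) XOR (2 * (4 * n + 1)) = 1 + 2 * ((2 * n) XOR (4 * n + 1))"
    by (subst xor_rec) simp
  also have "(2 * n) XOR (4 * n + 1) = 1 + 2 * (n XOR (2 * n))"
    by (subst xor_rec) simp
  finally show ?thesis using assms by simp
qed

lemma xor_double_4_plus_3: "(4 * n + 3) XOR (2 * (4 * n + 3)) \<noteq> 3 * (4 * n + 3)" for n :: nat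
proof
  assume eq: "(4 * n + 3) XOR (2 * (4 * n + 3)) = 3 * (4 * n + 3)"
  have half: "(4 * n + 3) div 2 = 2 * n + 1" by presburger
  have "(4 * n + 3) XOR (2 * (4 * n + 3)) = 1 + 2 * ((2 * n + 1) XOR (4 * n + 3))"
    by (subst xor_rec) (simp add: half)
  also have "(2 * n + 1) XOR (4 * n + 3) = 2 * (n XOR (2 * n + 1))"
    by (subst xor_rec) (simp add: half)
  finally have "n XOR (2 * n + 1) = 3 * n + 2" using eq by simp
  \<comment> \<open>The left side is odd iff \<open>n\<close> is even, whereas
    \<open>3 * n + 2\<close> has the parity of \<open>n\<close>.\<close>
  then show False using even_xor_iff[of n "2 * n + 1"] by simp
qed

section \<open>Arithmetic progressions that leave each language\<close>

lemma not_context_free_P_words: "\<not> context_free_lang P_words"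
proof
  assume "context_free_lang P_words"
  moreover have "nim_word (2 ^ m) (2 * 2 ^ m) (3 * 2 ^ m) \<in> P_words" for m
    using xor_double_power2[of m 1] xor_rec[of 1 "2 :: nat"] by (simp add: P_words_def Ppos_nim_word)
  ultimately obtain m m' where m: "m < m'"
    "\<forall>t n. n = 2 ^ m + t * (2 ^ m' - 2 ^ m) \<longrightarrow> nim_word n (2 * n) (3 * n) \<in> P_words"
    by (rule context_free_nim_words[of P_words "\<lambda>m. 2 ^ m"])
  obtain c where c: "m' = m + Suc c" using m(1) less_imp_Suc_add by auto
  define e :: nat where "e = 2 ^ Suc c - 1"
  have "(2::nat) ^ m' - 2 ^ m = 2 ^ m * e"
    by (simp add: c e_def power_add right_diff_distrib')
  moreover have "4 * (2 ^ c - 1) + 3 = 1 + 2 * e"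
    using one_le_power[of "2::nat" c] unfolding e_def power_Suc by linarith
  \<comment> \<open>The term \<open>t = 2\<close> of the progression is
    \<open>2 ^ m * (2 ^ (c + 2) - 1)\<close>, whose ones form a block of length at least
    two.\<close>
  ultimately have "2 ^ m * (4 * (2 ^ c - 1) + 3) = 2 ^ m + 2 * (2 ^ m' - 2 ^ m :: nat)"
    by (simp add: algebra_simps)
  from m(2)[rule_format, OF this] show False
    unfolding P_words_def mem_Collect_eq Ppos_nim_word xor_double_power2 using xor_double_4_plus_3 by blast
qed

text \<open>With \<open>4 ^ c = 1 + 3 * k\<close>, cubing shows that \<open>64 ^ c - 1\<close> is a
  multiple of \<open>9 * k = 3 * (4 ^ c - 1)\<close>, and \<open>2 ^ c - 1\<close> divides
  \<open>4 ^ c - 1\<close>.\<close>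

lemma power2_eq_1_mod:
  obtains s where "(2::nat) ^ (6 * c) = 1 + 3 * (2 ^ c - 1) * s"
proof -
  obtain u where u: "(2::nat) ^ c = u + 1"
    using one_le_power[of "2::nat" c] by (metis add.commute le_add_diff_inverse one_le_numeral)
  have "(4::nat) ^ c mod 3 = 1" using power_mod[of "4 :: nat" 3 c] by simp
  then obtain k where k: "(4::nat) ^ c = 3 * k + 1" by (metis mult_div_mod_eq)
  have "(4::nat) ^ c = (2 ^ c) ^ 2" by (simp add: power2_eq_square flip: power_mult_distrib)
  then have uk: "3 * k = u * (u + 2)" using k u by (simp add: power2_eq_square)
  have "((4::nat) ^ c) ^ 3 = (4 ^ 3) ^ c" by (simp only: power_mult[symmetric] mult.commute)
  then have "(2::nat) ^ (6 * c) = (4 ^ c) ^ 3" by (simp add: power_mult)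
  also have "\<dots> = 1 + 3 * (3 * k) * (3 * k * k + 3 * k + 1)"
    unfolding k by (simp add: power3_eq_cube algebra_simps)
  finally show thesis using that u uk by (metis add_diff_cancel_right' mult.assoc)
qed

lemma not_context_free_N_words: "\<not> context_free_lang N_words"
proof
  assume "context_free_lang N_words"
  moreover have "nim_word (3 * 2 ^ m) (2 * (3 * 2 ^ m)) (3 * (3 * 2 ^ m)) \<in> N_words" for m
    using xor_double_power2[of m 3] xor_double_4_plus_3[of 0]
    by (simp add: N_words_def P_words_def Ppos_nim_word ac_simps)
  ultimately obtain m m' where m: "m < m'"
    "\<forall>t n. n = 3 * 2 ^ m + t * (3 * 2 ^ m' - 3 * 2 ^ m) \<longrightarrow> nim_word n (2 * n) (3 * n) \<in> N_words"
    by (rule context_free_nim_words[of N_words "\<lambda>m. 3 * 2 ^ m"])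
  obtain c where c: "m' = m + Suc c" using m(1) less_imp_Suc_add by auto
  \<comment> \<open>Up to the factor \<open>2 ^ m\<close>, the progression starts at 3 and has
    difference \<open>d\<close>.\<close>
  define d :: nat where "d = 3 * (2 ^ Suc c - 1)"
  obtain s where s: "(2::nat) ^ (6 * Suc c) = 1 + d * s"
    using power2_eq_1_mod[of "Suc c"] unfolding d_def by blast
  \<comment> \<open>Chosen so that \<open>4 * y = 2 ^ (6 * c + 6)\<close>, a power of two congruent
    to 1 modulo \<open>d\<close>.\<close>
  define y :: nat where "y = 2 ^ (6 * c + 4)"
  have y: "4 * y = 1 + d * s" using s by (simp add: y_def power_add)
  \<comment> \<open>With \<open>z = 4 * y\<close> this is \<open>z * z + z + 1\<close>: it is
    congruent to 3 modulo \<open>d\<close>, and its three binary ones are isolated.\<close>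
  define r where "r = 4 * (y * (4 * y + 1)) + 1"
  have one: "(1::nat) XOR (2 * 1) = 3 * 1" using xor_rec[of 1 "2 :: nat"] by simp
  have "y XOR (2 * y) = 3 * y"
    using one xor_double_power2[of "6 * c + 4" 1] by (simp add: y_def)
  from xor_double_4_plus_1[OF this]
  have "(y * (4 * y + 1)) XOR (2 * (y * (4 * y + 1))) = 3 * (y * (4 * y + 1))"
    unfolding y_def xor_double_power2 .
  from xor_double_4_plus_1[OF this] have "r XOR (2 * r) = 3 * r" unfolding r_def .
  then have "nim_word (2 ^ m * r) (2 * (2 ^ m * r)) (3 * (2 ^ m * r)) \<notin> N_words"
    unfolding N_words_def P_words_def by (simp add: Ppos_nim_word xor_double_power2)
  moreover have "r = (4 * y) * (4 * y) + 4 * y + 1" by (simp add: r_def algebra_simps)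
  \<comment> \<open>Expanding with \<open>4 * y = 1 + d * s\<close> yields the index
    \<open>t\<close> of \<open>r\<close> in the progression.\<close>
  then have "r = 3 + (3 * s + d * s * s) * d" unfolding y by (simp add: algebra_simps)
  moreover have "(3::nat) * 2 ^ m' - 3 * 2 ^ m = 2 ^ m * d"
    by (simp add: c d_def power_add algebra_simps)
  ultimately show False
    using m(2)[rule_format, of "2 ^ m * r" "3 * s + d * s * s"] by (simp add: algebra_simps)
qed

section \<open>Non-regularity\<close>

lemma nim_word_2_heaps: "nim_word a b 0 = heap_word a @ ([False, False] @ heap_word b @ [False, False] @ heap_word 0)"
  by (simp add: nim_word_def)

text \<open>Two distinct heap words reach the same state, so no common continuation separates them;
  yet continuing with heaps of sizes \<open>a\<close> and 0 gives Nim sum zero after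
  \<open>a\<close> and nonzero after \<open>b\<close>.\<close>

lemma not_regular_P_words: "\<not> regular_lang P_words"
proof
  assume "regular_lang P_words"
  then obtain Q :: "nat set" and \<delta> q0 F where "finite Q" "q0 \<in> Q" and closed: "\<forall>q\<in>Q. \<forall>a. \<delta> q a \<in> Q"
    and P: "P_words = {w. run \<delta> q0 w \<in> F}"
    unfolding regular_lang_def by blast
  have "run \<delta> q w \<in> Q" if "q \<in> Q" for q w
    using that closed by (induction w arbitrary: q) auto
  then have "range (\<lambda>n. run \<delta> q0 (heap_word n)) \<subseteq> Q" using \<open>q0 \<in> Q\<close> by blast
  then have "finite (range (\<lambda>n. run \<delta> q0 (heap_word n)))" using \<open>finite Q\<close> finite_subset by blast
  then have "\<not> inj (\<lambda>n. run \<delta> q0 (heap_word n))"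
    using finite_imageD[of _ "UNIV :: nat set"] infinite_UNIV_nat by blast
  then obtain a b where "a \<noteq> b" and ab: "run \<delta> q0 (heap_word a) = run \<delta> q0 (heap_word b)"
    by (auto simp: inj_def)
  have "nim_word a a 0 \<in> P_words \<longleftrightarrow> nim_word b a 0 \<in> P_words"
    unfolding P nim_word_2_heaps using ab by simp
  moreover have "b XOR a \<noteq> 0" using \<open>a \<noteq> b\<close> xor_cancel_eq[of a b a] by (simp add: xor.commute)
  ultimately show False by (simp add: P_words_def Ppos_nim_word)
qed

lemma regular_lang_complement: "regular_lang L \<Longrightarrow> regular_lang (UNIV - L)"
  unfolding regular_lang_def
proof (elim exE conjE)
  fix Q :: "nat set" and \<delta> q0 F
  assume Q: "finite Q" "q0 \<in> Q" "F \<subseteq> Q" "\<forall>q\<in>Q. \<forall>a. \<delta> q a \<in> Q" and L: "L = {w. run \<delta> q0 w \<in> F}"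
  have "run \<delta> q w \<in> Q" if "q \<in> Q" for q w
    using that Q(4) by (induction w arbitrary: q) auto
  then have "UNIV - L = {w. run \<delta> q0 w \<in> Q - F}" using L Q(2) by auto
  then show "\<exists>Q \<delta> q0 F. finite (Q :: nat set) \<and> q0 \<in> Q \<and> F \<subseteq> Q \<and> (\<forall>q\<in>Q. \<forall>a. \<delta> q a \<in> Q)
      \<and> UNIV - L = {w. run \<delta> q0 w \<in> F}"
    using Q by (intro exI[of _ Q] exI[of _ \<delta>] exI[of _ q0] exI[of _ "Q - F"]) auto
qed

theorem theorem3:
  shows "\<not> regular_lang P_words \<and> \<not> regular_lang N_words \<and>
         \<not> context_free_lang P_words \<and> \<not> context_free_lang N_words"
proof -
  have "UNIV - N_words = P_words" by (auto simp: N_words_def)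
  then have "\<not> regular_lang N_words"
    using regular_lang_complement[of N_words] not_regular_P_words by auto
  then show ?thesis
    using not_regular_P_words not_context_free_P_words not_context_free_N_words by blast
qed

end
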